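(* Let $S\colon \mathbb{Z}_{\ge 0}\to\mathbb{Z}_{\ge 0}$ and $u\colon \mathbb{Z}_{\ge 0}\to\mathbb{Z}_{\ge 0}$ be functions. Let $\pi\colon \mathbb{Z}_{\ge 0}^2\to\mathbb{Z}_{\ge 0}$ be a two-variable function that is weakly decreasing in the second variable and satisfies $\sum_{s=1}^{u(n)}\pi(n,s)=S(n)$. Then $$f(q)=\sum_{n=0}^{\infty}\frac{q^{S(n)}}{(q)_{u(n)}}$$ is the generating function of the partitions satisfying $$a_1 \ge_{\pi(n,1)-\pi(n,2)} \cdots \ge_{\pi(n,s-1)-\pi(n,s)} a_s\ge_{\pi(n,s)-\pi(n,s+1)} \cdots \ge_{\pi(n,u(n)-1)-\pi(n,u(n))} a_{u(n)}\ge_0 \pi(n,u(n)).$$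
   Context: For $n\in\mathbb{Z}$, $(q)_n:=\prod_{s=1}^n(1-q^s)$ if $n>0$ and $(q)_n:=1$ if $n\le 0$. For non-negative integers $a,b,r$, the notation $a\ge_r b$ means $a-b\ge r$ (so $\ge_0$ is $\ge$ and $\ge_1$ is $>$). A partition with at most $m$ parts is written as a chain $a_1\ge a_2\ge\dots\ge a_m\ge 0$, and its weight is $a_1+\dots+a_m$. In the chain of the claim, $n$ is the summation index of $f(q)$. *)

theory Defs
  imports "HOL-Computational_Algebra.Formal_Power_Series"
begin

definition q_poch :: "int \<Rightarrow> rat fps" where
  "q_poch n = (if n > 0 then (\<Prod>s = 1..nat n. 1 - fps_X ^ s) else 1)"

text \<open>The gap relation is stated over the integers, because truncated subtraction on
  \<^typ>\<open>nat\<close> would make it hold for \<open>r = 0\<close> and every \<open>a\<close>, \<open>b\<close>.\<close>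

definition ge_gap :: "nat \<Rightarrow> nat \<Rightarrow> nat \<Rightarrow> bool" where
  "ge_gap r a b \<longleftrightarrow> int a - int b \<ge> int r"

text \<open>A partition with at most \<open>m\<close> parts is a chain \<open>a 1 \<ge> \<dots> \<ge> a m \<ge> 0\<close>, encoded as a function
  that is zero outside \<open>{1..m}\<close>, so that distinct functions are distinct chains.\<close>

definition partitions_at_most :: "nat \<Rightarrow> (nat \<Rightarrow> nat) set" where
  "partitions_at_most m =
     {a. (\<forall>s\<in>{1..<m}. a s \<ge> a (s + 1)) \<and> (\<forall>s. s \<notin> {1..m} \<longrightarrow> a s = 0)}"

definition partition_weight :: "nat \<Rightarrow> (nat \<Rightarrow> nat) \<Rightarrow> nat" where
  "partition_weight m a = (\<Sum>s = 1..m. a s)"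

text \<open>The differences of \<open>\<pi>\<close> do not truncate when \<open>\<pi> n\<close> is weakly decreasing.
  For \<open>u n = 0\<close> the chain is empty, and the empty partition is the only element.\<close>

definition chain_partitions ::
  "(nat \<Rightarrow> nat \<Rightarrow> nat) \<Rightarrow> (nat \<Rightarrow> nat) \<Rightarrow> nat \<Rightarrow> (nat \<Rightarrow> nat) set" where
  "chain_partitions \<pi> u n =
     {a \<in> partitions_at_most (u n).
        (\<forall>s\<in>{1..<u n}. ge_gap (\<pi> n s - \<pi> n (s + 1)) (a s) (a (s + 1))) \<and>
        (u n > 0 \<longrightarrow> ge_gap 0 (a (u n)) (\<pi> n (u n)))}"

text \<open>The finiteness requirement says that the generating function exists as a formal power
  series. For the family of all chains it can fail, exactly when the series of summands
  diverges, since \<open>S\<close> is not assumed to tend to infinity.\<close>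

definition is_generating_function :: "rat fps \<Rightarrow> 'a set \<Rightarrow> ('a \<Rightarrow> nat) \<Rightarrow> bool" where
  "is_generating_function F A w \<longleftrightarrow>
     (\<forall>N. finite {x \<in> A. w x = N} \<and> fps_nth F N = of_nat (card {x \<in> A. w x = N}))"

end

theory Submission
  imports Defs
begin

text \<open>Subtracting the staircase \<open>\<pi> n 1, \<dots>, \<pi> n (u n)\<close> from a chain removes the gap conditions
  and lowers the weight by \<open>S n\<close>, so the \<open>n\<close>-th family is counted by \<open>q ^ S n\<close> times the generating
  function of partitions with at most \<open>u n\<close> parts. The latter is \<open>1 / (q)\<^sub>m\<close> by induction on \<open>m\<close>:
  either the last part vanishes, or the constant staircase \<open>1\<close> can be subtracted.
  Since all coefficients are nonnegative integers, the series converges exactly when each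
  coefficient receives only finitely many contributions.\<close>

text \<open>Convergence of formal power series means that each coefficient is eventually constant
  along the partial sums. Here the coefficient of the \<open>k\<close>-th partial sum counts the
  pairs of index below \<open>k\<close>, so it is constant exactly when no new pairs appear.\<close>

lemma sums_iff_is_generating_function:
  assumes gf: "\<And>n. is_generating_function (F n) (A n) (w n)"
  shows "F sums f \<longleftrightarrow> is_generating_function f (SIGMA n : UNIV. A n) (\<lambda>(n, a). w n a)"
proof -
  define B where "B N n = {a \<in> A n. w n a = N}" for N n
  have level: "{x \<in> (SIGMA n : UNIV. A n). (\<lambda>(n, a). w n a) x = N} = (SIGMA n : UNIV. B N n)" for N
    by (auto simp: B_def)
  have fin: "finite (B N n)" and coeff: "fps_nth (F n) N = of_nat (card (B N n))" for N n
    using gf[of n] by (auto simp: is_generating_function_def B_def)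
  have partial: "fps_nth (\<Sum>n<k. F n) N = of_nat (card (SIGMA n : {..<k}. B N n))" for N k
    by (simp add: fps_sum_nth coeff fin)
  have stable: "(\<forall>\<^sub>F k in sequentially. fps_nth (\<Sum>n<k. F n) N = fps_nth f N) \<longleftrightarrow>
      finite (SIGMA n : UNIV. B N n) \<and> fps_nth f N = of_nat (card (SIGMA n : UNIV. B N n))" for N
  proof
    assume "\<forall>\<^sub>F k in sequentially. fps_nth (\<Sum>n<k. F n) N = fps_nth f N"
    then obtain K where K: "of_nat (card (SIGMA n : {..<k}. B N n)) = fps_nth f N" if "k \<ge> K" for k
      unfolding eventually_sequentially partial by blast
    \<comment> \<open>Nested finite sets of equal cardinality coincide, so stable counts force
      stable sets.\<close>
    have same: "(SIGMA n : {..<K}. B N n) = (SIGMA n : {..<k}. B N n)" if "k \<ge> K" for k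
    proof (rule card_subset_eq)
      show "finite (SIGMA n : {..<k}. B N n)"
        using fin by auto
      show "(SIGMA n : {..<K}. B N n) \<subseteq> (SIGMA n : {..<k}. B N n)"
        using that by auto
      show "card (SIGMA n : {..<K}. B N n) = card (SIGMA n : {..<k}. B N n)"
        using K[OF that] K[of K] by (metis of_nat_eq_iff order_refl)
    qed
    have "(SIGMA n : UNIV. B N n) = (SIGMA n : {..<K}. B N n)"
    proof (intro equalityI subsetI)
      fix x assume "x \<in> (SIGMA n : UNIV. B N n)"
      \<comment> \<open>This bound is at least \<open>K\<close> and also exceeds the index of
        \<open>x\<close>.\<close>
      then have "x \<in> (SIGMA n : {..<max K (Suc (fst x))}. B N n)"
        by auto
      then show "x \<in> (SIGMA n : {..<K}. B N n)"
        using same[of "max K (Suc (fst x))"] by simp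
    qed auto
    then show "finite (SIGMA n : UNIV. B N n) \<and>
        fps_nth f N = of_nat (card (SIGMA n : UNIV. B N n))"
      using K[of K] fin by (metis finite_SigmaI finite_lessThan order_refl)
  next
    assume *: "finite (SIGMA n : UNIV. B N n) \<and>
        fps_nth f N = of_nat (card (SIGMA n : UNIV. B N n))"
    \<comment> \<open>Only finitely many indices occur in a finite set of pairs; beyond their bound
      the partial sums miss nothing.\<close>
    then obtain K where K: "fst x < K" if "x \<in> (SIGMA n : UNIV. B N n)" for x
      by (metis finite_imageI finite_nat_set_iff_bounded imageI)
    have "(SIGMA n : {..<k}. B N n) = (SIGMA n : UNIV. B N n)" if "k \<ge> K" for k
      using K that by fastforce
    then show "\<forall>\<^sub>F k in sequentially. fps_nth (\<Sum>n<k. F n) N = fps_nth f N"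
      unfolding eventually_sequentially partial using * by metis
  qed
  show ?thesis
    unfolding sums_def tendsto_fps_iff is_generating_function_def level using stable by blast
qed

lemma finite_partitions_at_most_weight:
  "finite {a \<in> partitions_at_most m. partition_weight m a = N}"
proof (rule finite_subset)
  show "{a \<in> partitions_at_most m. partition_weight m a = N} \<subseteq>
      {a. \<forall>s. (s \<in> {1..m} \<longrightarrow> a s \<in> {..N}) \<and> (s \<notin> {1..m} \<longrightarrow> a s = 0)}"
    by (auto simp: partitions_at_most_def partition_weight_def intro!: member_le_sum)
  show "finite {a. \<forall>s. (s \<in> {1..m} \<longrightarrow> a s \<in> {..N}) \<and> (s \<notin> {1..m} \<longrightarrow> a s = (0::nat))}"
    by (rule finite_set_of_finite_funs) auto
qed

text \<open>The gaps telescope down from index \<open>u n\<close>, where the last condition of the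
  chain starts the induction. This makes the truncated subtraction of the staircase
  reversible.\<close>

lemma chain_partitions_ge:
  assumes "antimono (\<pi> n)" and a: "a \<in> chain_partitions \<pi> u n" and "s \<in> {1..u n}"
  shows "\<pi> n s \<le> a s"
proof -
  have "s \<le> u n"
    using assms(3) by simp
  then show ?thesis
    using assms(3)
  proof (induction s rule: inc_induct)
    case base
    then show ?case
      using a by (auto simp: chain_partitions_def ge_gap_def)
  next
    case (step t)
    then have "ge_gap (\<pi> n t - \<pi> n (t + 1)) (a t) (a (t + 1))" and "\<pi> n (Suc t) \<le> a (Suc t)"
      using a by (auto simp: chain_partitions_def)
    then show ?case
      by (auto simp: ge_gap_def)
  qed
qed

text \<open>Adding \<open>\<pi> n s\<close> to the \<open>s\<close>-th part widens each gap by
  exactly the required difference and lifts the last part to its bound. The conditional keeps the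
  encoding zero outside \<open>{1..u n}\<close>.\<close>

lemma bij_betw_add_staircase:
  assumes "antimono (\<pi> n)"
  shows "bij_betw (\<lambda>b s. if s \<in> {1..u n} then b s + \<pi> n s else 0)
    (partitions_at_most (u n)) (chain_partitions \<pi> u n)"
proof (rule bij_betw_byWitness[where f' = "\<lambda>a s. if s \<in> {1..u n} then a s - \<pi> n s else 0"])
  have dec: "\<pi> n (Suc s) \<le> \<pi> n s" for s
    using assms by (simp add: antimonoD)
  show "\<forall>b\<in>partitions_at_most (u n). (\<lambda>s. if s \<in> {1..u n} then
      (if s \<in> {1..u n} then b s + \<pi> n s else 0) - \<pi> n s else 0) = b"
    by (auto simp: partitions_at_most_def fun_eq_iff)
  show "\<forall>a\<in>chain_partitions \<pi> u n. (\<lambda>s. if s \<in> {1..u n} then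
      (if s \<in> {1..u n} then a s - \<pi> n s else 0) + \<pi> n s else 0) = a"
    using chain_partitions_ge[of \<pi> n, OF assms]
    by (force simp: chain_partitions_def partitions_at_most_def fun_eq_iff)
  show "(\<lambda>b s. if s \<in> {1..u n} then b s + \<pi> n s else 0) ` partitions_at_most (u n)
      \<subseteq> chain_partitions \<pi> u n"
    using dec
    by (auto simp: chain_partitions_def partitions_at_most_def ge_gap_def add_mono of_nat_diff)
  show "(\<lambda>a s. if s \<in> {1..u n} then a s - \<pi> n s else 0) ` chain_partitions \<pi> u n
      \<subseteq> partitions_at_most (u n)"
  proof clarify
    fix a assume a: "a \<in> chain_partitions \<pi> u n"
    have "a (Suc s) - \<pi> n (Suc s) \<le> a s - \<pi> n s" if "s \<in> {1..<u n}" for s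
    proof -
      have "ge_gap (\<pi> n s - \<pi> n (s + 1)) (a s) (a (s + 1))"
        using a that by (auto simp: chain_partitions_def)
      then show ?thesis
        using dec[of s] by (auto simp: ge_gap_def of_nat_diff)
    qed
    then show "(\<lambda>s. if s \<in> {1..u n} then a s - \<pi> n s else 0) \<in> partitions_at_most (u n)"
      by (auto simp: partitions_at_most_def)
  qed
qed

text \<open>\<open>P\<close> stays abstract so that the shift can also be applied before the closed
  form \<open>1 / q_poch\<close> is known, namely in the induction that proves it.\<close>

lemma is_generating_function_chain_partitions:
  assumes "antimono (\<pi> n)" and P: "is_generating_function P (partitions_at_most (u n)) (partition_weight (u n))"
  shows "is_generating_function (fps_X ^ (\<Sum>s = 1..u n. \<pi> n s) * P)
    (chain_partitions \<pi> u n) (partition_weight (u n))"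
  unfolding is_generating_function_def
proof
  fix N
  define T where "T = (\<Sum>s = 1..u n. \<pi> n s)"
  define \<phi> where "\<phi> b s = (if s \<in> {1..u n} then b s + \<pi> n s else 0)" for b :: "nat \<Rightarrow> nat" and s
  have bij: "bij_betw \<phi> (partitions_at_most (u n)) (chain_partitions \<pi> u n)"
    using bij_betw_add_staircase[of \<pi> n u, OF assms(1)] by (simp add: \<phi>_def[abs_def])
  have weight: "partition_weight (u n) (\<phi> b) = partition_weight (u n) b + T" for b
    by (simp add: partition_weight_def \<phi>_def T_def sum.distrib)
  have "bij_betw \<phi> {b \<in> partitions_at_most (u n). partition_weight (u n) b + T = N}
      {a \<in> chain_partitions \<pi> u n. partition_weight (u n) a = N}"
    using bij_betw_imp_inj_on[OF bij] unfolding bij_betw_imp_surj_on[OF bij, symmetric]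
    by (auto simp: bij_betw_def inj_on_def weight)
  \<comment> \<open>For \<open>N < T\<close> the difference \<open>N - T\<close> would truncate to
    0, hence the case split; it matches the coefficients of \<open>fps_X ^ T * P\<close>.\<close>
  moreover have "{b \<in> partitions_at_most (u n). partition_weight (u n) b + T = N} =
      (if N < T then {} else {b \<in> partitions_at_most (u n). partition_weight (u n) b = N - T})"
    by auto
  ultimately have "bij_betw \<phi>
      (if N < T then {} else {b \<in> partitions_at_most (u n). partition_weight (u n) b = N - T})
      {a \<in> chain_partitions \<pi> u n. partition_weight (u n) a = N}"
    by simp
  from bij_betw_finite[OF this] bij_betw_same_card[OF this]
  show "finite {a \<in> chain_partitions \<pi> u n. partition_weight (u n) a = N} \<and>
      fps_nth (fps_X ^ (\<Sum>s = 1..u n. \<pi> n s) * P) N =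
      of_nat (card {a \<in> chain_partitions \<pi> u n. partition_weight (u n) a = N})"
    using P unfolding T_def[symmetric] fps_X_power_mult_nth
    by (auto simp: is_generating_function_def finite_partitions_at_most_weight split: if_splits)
qed

lemma q_poch_Suc: "q_poch (int (Suc m)) = q_poch (int m) * (1 - fps_X ^ Suc m)"
  unfolding q_poch_def nat_int of_nat_0_less_iff by (cases "m = 0") (simp_all del: power_Suc)

text \<open>Constant term 1 makes \<open>q_poch\<close> a unit, so that division by it is
  multiplication by the inverse.\<close>

lemma q_poch_nth_0: "fps_nth (q_poch (int m)) 0 = 1"
  by (induction m) (simp add: q_poch_def, simp only: q_poch_Suc fps_mult_nth_0, simp)

lemma is_generating_function_unique:
  "is_generating_function F A w \<Longrightarrow> is_generating_function G A w \<Longrightarrow> F = G"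
  by (simp add: is_generating_function_def fps_eq_iff)

lemma is_generating_function_Un:
  assumes "is_generating_function F A w" "is_generating_function G B w" "A \<inter> B = {}"
  shows "is_generating_function (F + G) (A \<union> B) w"
  unfolding is_generating_function_def
proof
  fix N
  have "{x \<in> A \<union> B. w x = N} = {x \<in> A. w x = N} \<union> {x \<in> B. w x = N}"
    and "{x \<in> A. w x = N} \<inter> {x \<in> B. w x = N} = {}"
    using assms(3) by auto
  then show "finite {x \<in> A \<union> B. w x = N} \<and>
      fps_nth (F + G) N = of_nat (card {x \<in> A \<union> B. w x = N})"
    using assms(1,2) by (simp add: is_generating_function_def card_Un_disjoint)
qed

lemma is_generating_function_cong:
  assumes "\<And>x. x \<in> A \<Longrightarrow> v x = w x"
  shows "is_generating_function F A v \<longleftrightarrow> is_generating_function F A w"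
proof -
  have "{x \<in> A. v x = N} = {x \<in> A. w x = N}" for N
    using assms by auto
  then show ?thesis
    by (simp add: is_generating_function_def)
qed

text \<open>The split is by whether the last part vanishes. For the constant staircase 1 all gaps
  are 0 and the last part is at least 1; the index 0 is a dummy.\<close>

lemma partitions_at_most_Suc:
  "partitions_at_most (Suc m) =
    partitions_at_most m \<union> chain_partitions (\<lambda>_ _. 1) (\<lambda>_. Suc m) 0"
  (is "_ = _ \<union> ?C")
proof (intro equalityI subsetI)
  fix a assume a: "a \<in> partitions_at_most (Suc m)"
  show "a \<in> partitions_at_most m \<union> ?C"
  proof (cases "a (Suc m) = 0")
    case True
    then have "a s = 0" if "s \<notin> {1..m}" for s
      using a that by (cases "s = Suc m") (auto simp: partitions_at_most_def)
    then show ?thesis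
      using a by (auto simp: partitions_at_most_def)
  next
    case False
    then show ?thesis
      using a by (auto simp: partitions_at_most_def chain_partitions_def ge_gap_def)
  qed
next
  fix a assume "a \<in> partitions_at_most m \<union> ?C"
  then show "a \<in> partitions_at_most (Suc m)"
  proof
    assume a: "a \<in> partitions_at_most m"
    then have "a (Suc s) \<le> a s" if "s \<in> {1..<Suc m}" for s
      \<comment> \<open>At \<open>s = m\<close> the next part lies outside \<open>{1..m}\<close> and
        is 0.\<close>
      using that by (cases "s = m") (auto simp: partitions_at_most_def)
    then show ?thesis
      using a by (auto simp: partitions_at_most_def)
  qed (auto simp: chain_partitions_def)
qed

lemma is_generating_function_partitions_at_most:
  "is_generating_function (1 / q_poch (int m)) (partitions_at_most m) (partition_weight m)"
proof (induction m)
  case 0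
  have "partitions_at_most 0 = {\<lambda>_. 0}"
    by (auto simp: partitions_at_most_def)
  then have "{a \<in> partitions_at_most 0. partition_weight 0 a = N} = (if N = 0 then {\<lambda>_. 0} else {})"
    for N
    by (auto simp: partition_weight_def)
  then show ?case
    by (simp add: is_generating_function_def q_poch_def)
next
  case (Suc m)
  define C where "C = chain_partitions (\<lambda>_ _. 1) (\<lambda>_. Suc m) 0"
  \<comment> \<open>The unknown series is defined by its counts; the split of the partitions gives
    \<open>P = 1 / (q)_m + q^(m+1) P\<close>, which is then solved for \<open>P\<close>.\<close>
  define P where "P = Abs_fps (\<lambda>N.
    of_nat (card {a \<in> partitions_at_most (Suc m). partition_weight (Suc m) a = N}) :: rat)"
  have P: "is_generating_function P (partitions_at_most (Suc m)) (partition_weight (Suc m))"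
    by (simp add: is_generating_function_def P_def finite_partitions_at_most_weight)
  have C: "is_generating_function (fps_X ^ Suc m * P) C (partition_weight (Suc m))"
    using is_generating_function_chain_partitions[of "\<lambda>_ _. 1" 0 P "\<lambda>_. Suc m"] P
    by (simp add: C_def monotone_def del: power_Suc)
  have "is_generating_function (1 / q_poch (int m)) (partitions_at_most m) (partition_weight (Suc m))"
  proof (subst is_generating_function_cong[where w = "partition_weight m"])
    show "partition_weight (Suc m) a = partition_weight m a" if "a \<in> partitions_at_most m" for a
      using that by (simp add: partition_weight_def partitions_at_most_def)
  qed (rule Suc.IH)
  moreover have "partitions_at_most m \<inter> C = {}"
    by (auto simp: C_def partitions_at_most_def chain_partitions_def ge_gap_def)
  ultimately have "is_generating_function (1 / q_poch (int m) + fps_X ^ Suc m * P)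
      (partitions_at_most (Suc m)) (partition_weight (Suc m))"
    unfolding partitions_at_most_Suc C_def[symmetric] using C
    by (intro is_generating_function_Un)
  from is_generating_function_unique[OF P this]
  have rec: "P * (1 - fps_X ^ Suc m) = 1 / q_poch (int m)"
    by (simp add: algebra_simps del: power_Suc)
  have unit: "1 / q_poch (int k) = inverse (q_poch (int k))" for k
    by (simp add: fps_divide_unit q_poch_nth_0)
  have "q_poch (int (Suc m)) * P = q_poch (int m) * (P * (1 - fps_X ^ Suc m))"
    unfolding q_poch_Suc by (simp only: mult_ac)
  also have "\<dots> = 1"
    unfolding rec unit by (simp add: inverse_mult_eq_1' q_poch_nth_0)
  finally have "P = 1 / q_poch (int (Suc m))"
    unfolding unit by (metis fps_inverse_unique)
  with P show ?case
    by simp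
qed

text \<open>An equivalence, since \<open>S\<close> need not tend to infinity: the series converges
  exactly when the family has a generating function. The family consists of pairs because one chain
  may occur for several \<open>n\<close> and counts once for each.\<close>

theorem theorem3p3:
  fixes S u :: "nat \<Rightarrow> nat" and \<pi> :: "nat \<Rightarrow> nat \<Rightarrow> nat" and f :: "rat fps"
  assumes "\<And>n. antimono (\<pi> n)"
    and "\<And>n. (\<Sum>s = 1..u n. \<pi> n s) = S n"
  shows "(\<lambda>n. fps_X ^ S n / q_poch (int (u n))) sums f \<longleftrightarrow>
    is_generating_function f (SIGMA n : UNIV. chain_partitions \<pi> u n)
      (\<lambda>(n, a). partition_weight (u n) a)"
proof (rule sums_iff_is_generating_function)
  fix n
  have "fps_X ^ S n / q_poch (int (u n)) = fps_X ^ S n * (1 / q_poch (int (u n)))"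
    by (simp add: fps_divide_unit q_poch_nth_0)
  then show "is_generating_function (fps_X ^ S n / q_poch (int (u n)))
      (chain_partitions \<pi> u n) (partition_weight (u n))"
    using is_generating_function_chain_partitions
      [of \<pi> n _ u, OF assms(1) is_generating_function_partitions_at_most]
    by (simp only: assms(2))
qed

end
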